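(* The following generalized recurrence relation holds for Apostol-Bernoulli numbers of higher order: for integers $n,m\ge 0$ and $l\ge 1$, $$\frac{\mathcal{B}_{n+m+l}^{(l)}(\lambda)}{\binom{n+m+l}{l}\,l}=\sum_{k=0}^{m}\sum_{j=0}^{n}\genfrac{\{}{\}}{0pt}{}{m}{k}\binom{n}{j}\binom{l+k+j}{j}^{-1}\frac{(-\lambda)^{k}\,k^{\,n-j}}{l+k}\,\mathcal{B}_{l+k+j}^{(l+k)}(\lambda).$$
   Context: $\genfrac{\{}{\}}{0pt}{}{m}{k}$ are the Stirling numbers of the second kind. The Apostol-Bernoulli numbers of order $r$ are defined, for a parameter $\lambda$, by $\left(\frac{t}{\lambda e^t-1}\right)^{r}=\sum_{n\ge0}\mathcal{B}_n^{(r)}(\lambda)\frac{t^n}{n!}$ (with $|t|<\pi$ when $\lambda=1$ and $|t|<|\log\lambda|$ when $\lambda\neq1$). No restriction on $\lambda$ is stated. Convention: $0^0=1$.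
   Formalization: The case λ = 1 is excluded, since the identity fails there: for l = m = 1, n = 0 the left side is 1/12 and the right side is −5/12; the identity is stated for all complex λ ≠ 1. *)

theory Defs
  imports "HOL-Analysis.FPS_Convergence" "HOL-Combinatorics.Stirling"
begin

text \<open>
  The generating function $t / (\lambda e^t - 1)$ is read as a formal power series in $t$. For
  $\lambda = 1$ the denominator is not a unit, but it has order 1, so that the division of power
  series is exact and the quotient is the expansion of the function with its removable singularity
  at 0 removed. The lemma \<open>apostol_bernoulli_sums\<close> relates this to the convergent expansion.
\<close>

definition apostol_bernoulli_fps :: "complex \<Rightarrow> complex fps" where
  "apostol_bernoulli_fps lam = fps_X / (fps_const lam * fps_exp 1 - 1)"

definition apostol_bernoulli :: "nat \<Rightarrow> nat \<Rightarrow> complex \<Rightarrow> complex" where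
  "apostol_bernoulli r n lam = fact n * fps_nth (apostol_bernoulli_fps lam ^ r) n"

lemma apostol_bernoulli_denom:
  fixes lam :: complex
  defines "D \<equiv> fps_const lam * fps_exp 1 - 1"
  shows "D \<noteq> 0" "subdegree D \<le> 1"
proof -
  have 1: "fps_nth D 1 = lam" "fps_nth D 0 = lam - 1"
    by (simp_all add: D_def)
  show "D \<noteq> 0"
    using 1 by (metis diff_0 fps_zero_nth zero_neq_neg_one)
  have "fps_nth D 0 \<noteq> 0 \<or> fps_nth D 1 \<noteq> 0"
    using 1 by auto
  thus "subdegree D \<le> 1"
    by (metis subdegree_leI zero_le_one order.trans)
qed

lemma apostol_bernoulli_fps_mult:
  "apostol_bernoulli_fps lam * (fps_const lam * fps_exp 1 - 1) = fps_X"
proof -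
  have "(fps_const lam * fps_exp 1 - 1) dvd (fps_X :: complex fps)"
    using apostol_bernoulli_denom[of lam] by (simp add: fps_dvd_iff)
  thus ?thesis by (simp add: apostol_bernoulli_fps_def)
qed

lemma apostol_bernoulli_sums:
  "\<forall>\<^sub>F t in at 0.
     (\<lambda>n. apostol_bernoulli r n lam * t ^ n / fact n) sums (t / (lam * exp t - 1)) ^ r"
proof -
  define D :: "complex fps" where "D = fps_const lam * fps_exp 1 - 1"
  have D: "(\<lambda>t. lam * exp t - 1) has_fps_expansion D"
    unfolding D_def by (intro fps_expansion_intros)
  have "(\<lambda>t. if t = 0 then fps_nth fps_X (subdegree D) / fps_nth D (subdegree D)
               else t / (lam * exp t - 1)) has_fps_expansion (fps_X / D)"
    using apostol_bernoulli_denom[of lam]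
    by (intro has_fps_expansion_divide D has_fps_expansion_fps_X) (auto simp: D_def)
  hence "(\<lambda>t. (if t = 0 then fps_nth fps_X (subdegree D) / fps_nth D (subdegree D)
               else t / (lam * exp t - 1)) ^ r) has_fps_expansion (apostol_bernoulli_fps lam ^ r)"
    unfolding apostol_bernoulli_fps_def D_def
    by (induction r) (auto simp del: power_Suc simp: power_Suc intro!: has_fps_expansion_mult)
  hence R: "fps_conv_radius (apostol_bernoulli_fps lam ^ r) > 0"
    and E: "\<forall>\<^sub>F t in nhds 0. eval_fps (apostol_bernoulli_fps lam ^ r) t =
        (if t = 0 then fps_nth fps_X (subdegree D) / fps_nth D (subdegree D)
               else t / (lam * exp t - 1)) ^ r"
    by (auto simp: has_fps_expansion_def)
  have "\<forall>\<^sub>F t in nhds 0. t \<in> eball (0::complex) (fps_conv_radius (apostol_bernoulli_fps lam ^ r))"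
    using R by (intro eventually_nhds_in_open) (auto simp: zero_ereal_def)
  hence "\<forall>\<^sub>F t in at 0. t \<in> eball (0::complex) (fps_conv_radius (apostol_bernoulli_fps lam ^ r))"
    by (simp add: eventually_at_filter eventually_mono)
  moreover have "\<forall>\<^sub>F t in at 0. eval_fps (apostol_bernoulli_fps lam ^ r) t =
       (t / (lam * exp t - 1)) ^ r"
    using E by (auto simp: eventually_at_filter elim!: eventually_mono)
  ultimately show ?thesis
  proof eventually_elim
    case (elim t)
    have "(\<lambda>n. fps_nth (apostol_bernoulli_fps lam ^ r) n * t ^ n) sums
        eval_fps (apostol_bernoulli_fps lam ^ r) t"
      using elim by (intro sums_eval_fps) (simp add: in_eball_iff)
    thus ?case
      using elim by (simp add: apostol_bernoulli_def)
  qed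
qed

text \<open>
  The recurrence for the numbers of order $l$ has to exclude $\lambda = 1$: it rests on the Leibniz
  rule at $t = 0$ for $e^{kt} / (\lambda e^t - 1)^{l+k}$, which for $\lambda = 1$ has a pole there.
  Already for $l = m = 1$ and $n = 0$ the two sides are $\mathcal{B}_2^{(1)}(1) / 2 = 1/12$ and
  $- \mathcal{B}_2^{(2)}(1) / 2 = -5/12$.
\<close>

lemma recurrence_fails_at_1:
  defines "lam \<equiv> 1" and "l \<equiv> 1" and "m \<equiv> 1" and "n \<equiv> 0"
  shows "apostol_bernoulli l (n + m + l) lam / (of_nat ((n + m + l) choose l) * of_nat l) \<noteq>
    (\<Sum>k=0..m. \<Sum>j=0..n.
      of_nat (Stirling m k) * of_nat (n choose j) * inverse (of_nat ((l + k + j) choose j)) *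
      ((- lam) ^ k * of_nat k ^ (n - j) / of_nat (l + k)) *
      apostol_bernoulli (l + k) (l + k + j) lam)"
proof -
  define B where "B = apostol_bernoulli_fps 1"
  have eq: "fps_nth (B * (fps_const 1 * fps_exp 1 - 1)) i = fps_nth fps_X i" for i
    unfolding B_def by (simp only: apostol_bernoulli_fps_mult)
  have b0: "fps_nth B 0 = 1"
    using eq[of 1] by (simp add: fps_mult_nth)
  have b1: "fps_nth B 1 = - 1 / 2"
    using eq[of 2] b0 by (simp add: fps_mult_nth numeral_2_eq_2 eq_neg_iff_add_eq_0 add.commute)
  have b2: "fps_nth B 2 = 1 / 12"
  proof -
    have "1 + 3 * fps_nth B 1 + 6 * fps_nth B 2 = 0"
      using eq[of 3] b0 by (simp add: fps_mult_nth numeral_2_eq_2 numeral_3_eq_3 field_simps)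
    thus ?thesis unfolding b1 by (simp add: field_simps eq_neg_iff_add_eq_0 add.commute)
  qed
  have "fps_nth (B ^ 2) 2 = 2 * fps_nth B 2 * fps_nth B 0 + fps_nth B 1 * fps_nth B 1"
    by (simp add: power2_eq_square fps_mult_nth numeral_2_eq_2)
  hence B2: "fps_nth (B ^ 2) 2 = 5 / 12"
    by (simp add: b0 b1 b2 del: One_nat_def)
  show ?thesis
    by (simp add: b2 B2[unfolded power2_eq_square] lam_def l_def m_def n_def
             apostol_bernoulli_def flip: B_def numeral_2_eq_2)
qed

end

theory Submission
  imports Defs
begin

text \<open>
  Put $G = 1 / (\lambda e^t - 1)$, a unit power series since $\lambda \neq 1$. Then
  $\mathcal{B}_{r+j}^{(r)}(\lambda) = (r+j)! \, [t^j] G^r$, and $G' = - \lambda e^t G^2$ implies that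
  $F_k = (-\lambda)^k (l+k-1)! \, e^{kt} G^{l+k}$ satisfies $F_k' = k F_k + F_{k+1}$. By the recurrence
  of the Stirling numbers the $m$-th derivative of $F_0$ is $\sum_k S(m,k) F_k$; the claim compares
  the coefficients of $t^n / n!$ on both sides.
\<close>

text \<open>Differentiating once more keeps \<open>k\<close> times the coefficient at
  \<open>F k\<close> and adds a copy of it at \<open>F (Suc k)\<close>, which is the recurrence
  S(m+1,k+1) = (k+1) S(m,k+1) + S(m,k).\<close>

lemma fps_nth_deriv_Stirling:
  fixes F :: "nat \<Rightarrow> 'a::comm_semiring_1 fps"
  assumes "\<And>k. fps_deriv (F k) = of_nat k * F k + F (Suc k)"
  shows "fps_nth_deriv m (F 0) = (\<Sum>k\<le>m. of_nat (Stirling m k) * F k)"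
proof (induction m)
  case 0
  show ?case by simp
next
  case (Suc m)
  have "fps_nth_deriv (Suc m) (F 0) = fps_deriv (\<Sum>k\<le>m. of_nat (Stirling m k) * F k)"
    by (simp only: fps_nth_deriv_commute Suc.IH)
  also have "\<dots> = (\<Sum>k\<le>m. of_nat (Stirling m k) * (of_nat k * F k + F (Suc k)))"
    by (simp add: fps_deriv_sum assms)
  also have "\<dots> = (\<Sum>k\<le>m. of_nat (k * Stirling m k) * F k) +
      (\<Sum>k\<le>m. of_nat (Stirling m k) * F (Suc k))"
    by (simp add: sum.distrib algebra_simps)
  \<comment> \<open>The extra term is zero because S(m,m+1) = 0; the shift that follows then loses
    only the term with factor \<open>k\<close> = 0.\<close>
  also have "(\<Sum>k\<le>m. of_nat (k * Stirling m k) * F k) =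
      (\<Sum>k\<le>Suc m. of_nat (k * Stirling m k) * F k)"
    by simp
  also have "\<dots> = (\<Sum>k\<le>m. of_nat (Suc k * Stirling m (Suc k)) * F (Suc k))"
    by (subst sum.atMost_Suc_shift) simp
  also have "\<dots> + (\<Sum>k\<le>m. of_nat (Stirling m k) * F (Suc k)) =
      (\<Sum>k\<le>m. of_nat (Stirling (Suc m) (Suc k)) * F (Suc k))"
    by (simp add: sum.distrib algebra_simps)
  \<comment> \<open>The term restored at \<open>k\<close> = 0 is zero because S(m+1,0) = 0.\<close>
  also have "\<dots> = (\<Sum>k\<le>Suc m. of_nat (Stirling (Suc m) k) * F k)"
    by (subst sum.atMost_Suc_shift) simp
  finally show ?case .
qed

text \<open>Both sides are the derivative of order n+m at 0; stated with factorials, the shift needs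
  no division.\<close>

lemma fact_mult_fps_nth_deriv_nth:
  fixes f :: "'a::{comm_semiring_1,semiring_char_0} fps"
  shows "fact n * fps_nth (fps_nth_deriv m f) n = fact (n + m) * fps_nth f (n + m)"
  by (induction m arbitrary: f) (simp_all add: algebra_simps)

text \<open>The denominator has constant term \<open>lam - 1\<close>, hence is a unit, and the
  factor \<open>fps_X ^ r\<close> of the generating function shifts the index by
  \<open>r\<close>.\<close>

lemma apostol_bernoulli_add:
  assumes "lam \<noteq> 1"
  shows "apostol_bernoulli r (r + j) lam =
    fact (r + j) * fps_nth (inverse (fps_const lam * fps_exp 1 - 1) ^ r) j"
proof -
  have "apostol_bernoulli_fps lam = fps_X * inverse (fps_const lam * fps_exp 1 - 1)"
    using assms unfolding apostol_bernoulli_fps_def by (intro fps_divide_unit) simp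
  thus ?thesis
    by (simp add: apostol_bernoulli_def power_mult_distrib fps_X_power_mult_nth)
qed

theorem corollary12:
  fixes lam :: complex and n m l :: nat
  assumes "l \<ge> 1" and "lam \<noteq> 1"
  shows "apostol_bernoulli l (n + m + l) lam / (of_nat ((n + m + l) choose l) * of_nat l) =
    (\<Sum>k=0..m. \<Sum>j=0..n.
      of_nat (Stirling m k) * of_nat (n choose j) * inverse (of_nat ((l + k + j) choose j)) *
      ((- lam) ^ k * of_nat k ^ (n - j) / of_nat (l + k)) *
      apostol_bernoulli (l + k) (l + k + j) lam)"
proof -
  \<comment> \<open>With \<open>p\<close> = l-1, the factorial (l+k-1)! becomes
    \<open>fact (p + k)\<close> without truncated subtraction.\<close>
  obtain p where l: "l = Suc p"
    using assms(1) by (cases l) auto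
  define G where "G = inverse (fps_const lam * fps_exp 1 - 1)"
  \<comment> \<open>The constant is (l-1)! times the product of the factors \<open>-lam\<close>
    (l+i), i < k, that arise from differentiating the powers of \<open>G\<close>; thus
    \<open>F (Suc k)\<close> enters the derivative of \<open>F k\<close> with coefficient 1.\<close>
  define F where
    "F k = fps_const ((- lam) ^ k * fact (p + k)) * (fps_exp (of_nat k) * G ^ (l + k))" for k
  have deriv_G: "fps_deriv G = - (fps_const lam * fps_exp 1 * G ^ 2)"
    using assms(2) unfolding G_def by (subst fps_inverse_deriv) simp_all
  have deriv_F: "fps_deriv (F k) = of_nat k * F k + F (Suc k)" for k
  proof -
    define q where "q = p + k"
    define c where "c = fps_const ((- lam) ^ k * fact q)"
    define E where "E = (fps_exp (of_nat k) :: complex fps)"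
    have F_k: "F k = c * (E * G ^ Suc q)"
      by (simp add: F_def c_def E_def q_def l)
    have E_Suc: "fps_exp (of_nat (Suc k)) = E * fps_exp 1"
      unfolding E_def by (simp add: add.commute flip: fps_exp_add_mult)
    have c_Suc: "fps_const ((- lam) ^ Suc k * fact (p + Suc k)) =
        - (fps_const lam * of_nat (Suc q) * c)"
      unfolding c_def by (simp add: q_def fps_of_nat [symmetric] mult_ac del: of_nat_Suc)
    have F_Suc_k: "F (Suc k) = - (fps_const lam * of_nat (Suc q) * c) *
        (E * fps_exp 1 * G ^ (q + 2))"
      unfolding F_def E_Suc c_Suc by (simp add: q_def l)
    have deriv_power: "fps_deriv (G ^ Suc q) =
        - (of_nat (Suc q) * fps_const lam * fps_exp 1 * G ^ (q + 2))"
      by (simp only: fps_deriv_power' deriv_G) (simp add: algebra_simps power2_eq_square)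
    have deriv_E: "fps_deriv E = of_nat k * E"
      by (simp add: E_def fps_of_nat)
    have "fps_deriv (F k) = c * (E * fps_deriv (G ^ Suc q) + fps_deriv E * G ^ Suc q)"
      unfolding F_k by (simp add: c_def del: power_Suc)
    thus ?thesis
      unfolding F_k F_Suc_k deriv_power deriv_E
      by (simp only: algebra_simps mult_minus_left mult_minus_right)
  qed
  have coeff: "fact n * fps_nth (F k) n = (\<Sum>j=0..n. of_nat (n choose j) *
      inverse (of_nat ((l + k + j) choose j)) * ((- lam) ^ k * of_nat k ^ (n - j) / of_nat (l + k)) *
      apostol_bernoulli (l + k) (l + k + j) lam)" for k
  proof -
    have "fact n * fps_nth (F k) n = (\<Sum>j=0..n. (- lam) ^ k * fact (p + k) *
        (fact n / fact (n - j) * of_nat k ^ (n - j) * fps_nth (G ^ (l + k)) j))"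
      unfolding F_def fps_mult_left_const_nth
      \<comment> \<open>Swapping the factors makes \<open>j\<close> index the power of
        \<open>G\<close>, and the exponential contributes k^(n-j) / (n-j)!.\<close>
      unfolding mult.commute [of "fps_exp _"] fps_mult_nth
      by (simp add: sum_distrib_left mult_ac)
    also have "\<dots> = (\<Sum>j=0..n. of_nat (n choose j) *
      inverse (of_nat ((l + k + j) choose j)) * ((- lam) ^ k * of_nat k ^ (n - j) / of_nat (l + k)) *
      apostol_bernoulli (l + k) (l + k + j) lam)"
    proof (intro sum.cong refl)
      fix j assume "j \<in> {0..n}"
      hence b: "of_nat (n choose j) = (fact n / (fact j * fact (n - j)) :: complex)"
        by (intro binomial_fact) simp
      have b': "of_nat ((l + k + j) choose j) = (fact (l + k + j) / (fact j * fact (l + k)) :: complex)"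
        by (subst binomial_fact) simp_all
      have f: "fact (l + k) = (of_nat (l + k) * fact (p + k) :: complex)"
        by (simp add: l)
      have nz: "of_nat (l + k) \<noteq> (0 :: complex)"
        using l by (metis add_Suc of_nat_eq_0_iff nat.distinct(1))
      show "(- lam) ^ k * fact (p + k) *
          (fact n / fact (n - j) * of_nat k ^ (n - j) * fps_nth (G ^ (l + k)) j) =
        of_nat (n choose j) * inverse (of_nat ((l + k + j) choose j)) *
          ((- lam) ^ k * of_nat k ^ (n - j) / of_nat (l + k)) *
          apostol_bernoulli (l + k) (l + k + j) lam"
        \<comment> \<open>The factor (l+k+j)! of the Bernoulli number cancels against the binomial
          coefficient, and (l+k)! / (l+k) leaves (l+k-1)!.\<close>
        unfolding b b' f apostol_bernoulli_add [OF assms(2)] G_def [symmetric]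
        using nz by (auto simp: divide_simps simp del: of_nat_add)
    qed
    finally show ?thesis .
  qed
  \<comment> \<open>Here \<open>F 0\<close> is (l-1)! times \<open>G ^ l\<close>, and dividing
    (n+m+l)! by the denominator leaves (n+m)! (l-1)!.\<close>
  have "apostol_bernoulli l (n + m + l) lam / (of_nat ((n + m + l) choose l) * of_nat l) =
      fact (n + m) * fps_nth (F 0) (n + m)"
  proof -
    have "of_nat ((n + m + l) choose l) = (fact (n + m + l) / (fact l * fact (n + m)) :: complex)"
      by (subst binomial_fact) simp_all
    moreover have "fact l = (of_nat l * fact p :: complex)" "of_nat l \<noteq> (0 :: complex)"
      by (simp_all add: l del: of_nat_Suc)
    moreover have "apostol_bernoulli l (n + m + l) lam = fact (n + m + l) * fps_nth (G ^ l) (n + m)"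
      using apostol_bernoulli_add [OF assms(2), of l "n + m"] by (simp add: G_def add_ac)
    ultimately show ?thesis
      by (simp add: F_def)
  qed
  also have "\<dots> = fact n * fps_nth (fps_nth_deriv m (F 0)) n"
    by (simp only: fact_mult_fps_nth_deriv_nth)
  also have "\<dots> = (\<Sum>k=0..m. of_nat (Stirling m k) * (fact n * fps_nth (F k) n))"
    unfolding fps_nth_deriv_Stirling [of F, OF deriv_F]
    by (simp add: fps_sum_nth sum_distrib_left atMost_atLeast0 fps_of_nat [symmetric] mult_ac)
  also have "\<dots> = (\<Sum>k=0..m. \<Sum>j=0..n.
      of_nat (Stirling m k) * of_nat (n choose j) * inverse (of_nat ((l + k + j) choose j)) *
      ((- lam) ^ k * of_nat k ^ (n - j) / of_nat (l + k)) *
      apostol_bernoulli (l + k) (l + k + j) lam)"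
    by (simp only: coeff sum_distrib_left mult.assoc)
  finally show ?thesis .
qed

end
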